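(* Let $t_0\in T$, let $\sigma_{\max}(t)$ be simple for all $t\ge t_0$, and let $\|f(t,x)\|\le l(t)\|x\|$ hold for all $x\in\Omega_1$, $t\ge t_0$. Let $t_1=t_0+\delta_1$, where $\delta_1>0$ is such that, for all sufficiently small $\|x_0\|$ and $\hat F$, the solution $x(t,x_0)$ of $\dot x=A(t)x+f(t,x)+F(t)$ remains in $\Omega_1$ for $t\in[t_0,t_1]$. Assume that for some $t_*$ with $t_0\le t_*<t_1$ and some $\nu>0$, $$\sup_{t\ge t_*}\big(p(t)+k(t)l(t)\big)\le-\nu .$$ Then the trivial solution of $\dot x=A(t)x+f(t,x)$ is exponentially stable. If, in addition, $\hat F$ and $\|x_0\|$ are sufficiently small and $\sup_{t\ge t_0}k(t)=\hat k<\infty$ for all $t_0\in T$, then the corresponding solutions $x(t,x_0)$ of $\dot x=A(t)x+f(t,x)+F(t)$ are bounded in norm and $$\limsup_{t\to\infty}\|x(t,x_0)\|\le \hat F\hat k/\nu .$$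
   Context: $\|\cdot\|$ is the Euclidean norm on $\mathbb{R}^n$ and the induced spectral norm on matrices. $T=[\varsigma,\infty)$ with $\varsigma\in\mathbb{R}$, $t_0\in T$. Consider $\dot x=A(t)x+f(t,x)+F(t)$, $x\in\mathbb{R}^n$, $t\ge t_0$, and its homogeneous counterpart $\dot x=A(t)x+f(t,x)$, where $A(t)\in\mathbb{R}^{n\times n}$, $f:[t_0,\infty)\times\mathbb{R}^n\to\mathbb{R}^n$ and $F:[t_0,\infty)\to\mathbb{R}^n$ are continuous, $f(t,0)=0$, and $F(t)=\hat F\phi(t)$ with $\|\phi(t)\|=1$ and a scalar $\hat F\ge0$. The solution $x(t,x_0)$ with $x(t_0,x_0)=x_0$ is assumed to be uniquely defined for all $t\ge t_0$ whenever $x_0$ lies in a fixed neighborhood of $0$. $W(t)$ is a fundamental solution matrix of $\dot x=A(t)x$ normalized so that $\|W(t_0)\|=1$; $\sigma_{\max}(t)$ is its largest singular value, assumed to be simple for all $t\ge t_0$. Set $p(t)=\frac{d}{dt}\ln\|W(t)\|$ and $k(t)=\|W(t)\|\,\|W^{-1}(t)\|$. $\Omega_1\subset\mathbb{R}^n$ is a bounded neighborhood of $0$, and $l$ is a continuous function with $0<l(t)\le\hat l<\infty$ for all $t\ge t_0$. *)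

theory Defs
  imports "HOL-Analysis.Analysis"
begin

(* The class instance norm on "real ^ 'n ^ 'm" is the Frobenius norm, so the
   spectral norm has to be taken as an operator norm. *)
definition spectral_norm :: "real ^ 'n ^ 'n \<Rightarrow> real" where
  "spectral_norm M = onorm (\<lambda>v. M *v v)"

definition condition_number :: "real ^ 'n ^ 'n \<Rightarrow> real" where
  "condition_number M = spectral_norm M * spectral_norm (matrix_inv M)"

definition right_singular_space :: "real ^ 'n ^ 'n \<Rightarrow> real \<Rightarrow> (real ^ 'n) set" where
  "right_singular_space M \<sigma> = {v. (transpose M ** M) *v v = \<sigma>\<^sup>2 *\<^sub>R v}"

definition singular_value :: "real ^ 'n ^ 'n \<Rightarrow> real \<Rightarrow> bool" where
  "singular_value M \<sigma> \<longleftrightarrow> 0 \<le> \<sigma> \<and> (\<exists>v \<in> right_singular_space M \<sigma>. v \<noteq> 0)"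

definition sigma_max :: "real ^ 'n ^ 'n \<Rightarrow> real" where
  "sigma_max M = (GREATEST \<sigma>. singular_value M \<sigma>)"

(* Algebraic and geometric multiplicity coincide for the symmetric matrix
   transpose M ** M. *)
definition simple_singular_value :: "real ^ 'n ^ 'n \<Rightarrow> real \<Rightarrow> bool" where
  "simple_singular_value M \<sigma> \<longleftrightarrow> singular_value M \<sigma> \<and> dim (right_singular_space M \<sigma>) = 1"

(* x' = g(t, x) on the interval I, with one-sided derivatives at its endpoints. *)
definition ode_solution ::
    "(real \<Rightarrow> 'a \<Rightarrow> 'a) \<Rightarrow> real set \<Rightarrow> (real \<Rightarrow> 'a :: real_normed_vector) \<Rightarrow> bool" where
  "ode_solution g I x \<longleftrightarrow> (\<forall>t\<in>I. (x has_vector_derivative g t (x t)) (at t within I))"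

(* x is a solution on [t0, infinity) with x(t0) = x0, and every solution on an interval
   [t0, b] with the same initial value is a restriction of it. *)
definition unique_solution ::
    "(real \<Rightarrow> 'a \<Rightarrow> 'a) \<Rightarrow> real \<Rightarrow> 'a \<Rightarrow> (real \<Rightarrow> 'a :: real_normed_vector) \<Rightarrow> bool" where
  "unique_solution g t0 x0 x \<longleftrightarrow>
     ode_solution g {t0..} x \<and> x t0 = x0 \<and>
     (\<forall>b y. t0 < b \<and> ode_solution g {t0..b} y \<and> y t0 = x0 \<longrightarrow> (\<forall>t\<in>{t0..b}. y t = x t))"

definition fundamental_matrix ::
    "(real \<Rightarrow> real ^ 'n ^ 'n) \<Rightarrow> real \<Rightarrow> (real \<Rightarrow> real ^ 'n ^ 'n) \<Rightarrow> bool" where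
  "fundamental_matrix A t0 W \<longleftrightarrow>
     ode_solution (\<lambda>t M. A t ** M) {t0..} W \<and> (\<forall>t\<ge>t0. invertible (W t))"

(* p(t) = d/dt ln ||W(t)||, one-sided at t = t0 *)
definition log_norm_rate :: "real \<Rightarrow> (real \<Rightarrow> real ^ 'n ^ 'n) \<Rightarrow> real \<Rightarrow> real" where
  "log_norm_rate t0 W t = vector_derivative (\<lambda>s. ln (spectral_norm (W s))) (at t within {t0..})"

(* Exponential stability of the trivial solution for the initial time t0; the constants
   may depend on t0 (no uniformity with respect to the initial time). *)
definition exponentially_stable ::
    "(real \<Rightarrow> 'a \<Rightarrow> 'a :: real_normed_vector) \<Rightarrow> real \<Rightarrow> bool" where
  "exponentially_stable g t0 \<longleftrightarrow>
     (\<forall>t\<ge>t0. g t 0 = 0) \<and>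
     (\<exists>\<delta>>0. \<exists>C>0. \<exists>r>0. \<forall>x0. norm x0 < \<delta> \<longrightarrow>
        (\<exists>x. ode_solution g {t0..} x \<and> x t0 = x0) \<and>
        (\<forall>x. ode_solution g {t0..} x \<and> x t0 = x0 \<longrightarrow>
           (\<forall>t\<ge>t0. norm (x t) \<le> C * norm x0 * exp (- r * (t - t0)))))"

end

theory Submission
  imports Defs
begin

text \<open>
  The substitution \<open>x = W z\<close> turns the equation into \<open>z' = W\<inverse> (f + F)\<close>, so the growth of the norm of
  \<open>z\<close> is at most \<open>\<parallel>W\<inverse>\<parallel> (l \<parallel>x\<parallel> + F)\<close> while \<open>x\<close> stays in \<open>\<Omega>1\<close>. Let \<open>u\<close> be \<open>\<parallel>z(t0)\<parallel>\<close> plus the integral of this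
  bound. Then \<open>y = \<parallel>W\<parallel> u\<close> dominates \<open>\<parallel>x\<parallel>\<close>, and as \<open>p\<close> is the logarithmic derivative of \<open>\<parallel>W\<parallel>\<close>,
  \<open>y' = p y + k (l \<parallel>x\<parallel> + F) \<le> (p + k l) y + k F \<le> - \<nu> y + k F\<close> after the time \<open>t_star\<close>. Integration gives
  exponential decay for \<open>F = 0\<close> and the limit bound \<open>F k_hat / \<nu>\<close> in general
  (\<open>variation_of_parameters_majorant\<close>, \<open>linear_comparison\<close>, \<open>perturbed_solution_bound\<close>).

  This needs \<open>\<parallel>W\<parallel>\<close> to be differentiable, which is the role of the simple singular value: \<open>\<parallel>W\<parallel>\<close> is the
  maximum of \<open>u \<bullet> (W v)\<close> over unit vectors, the maximizer is unique up to a common sign, and a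
  maximum with an essentially unique maximizer inherits differentiability
  (\<open>envelope_has_real_derivative\<close>, \<open>spectral_norm_differentiable\<close>).

  Finally, all the estimates presuppose that the solution stays in \<open>\<Omega>1\<close>. On \<open>[t0, t_star]\<close> this is a
  hypothesis; afterwards the bound on \<open>y\<close> is, for small data, strictly smaller than the radius of a
  ball inside \<open>\<Omega>1\<close>, so the solution cannot reach the sphere (\<open>confined_by_strict_bound\<close>).
\<close>

section \<open>The spectral norm as largest singular value\<close>

lemma bounded_bilinear_matrix_vector:
  "bounded_bilinear ((*v) :: real ^ 'n ^ 'm \<Rightarrow> real ^ 'n \<Rightarrow> real ^ 'm)"
  by (intro bilinear_conv_bounded_bilinear[THEN iffD1])
     (auto simp: bilinear_def algebra_simps scaleR_matrix_vector_assoc intro!: linearI)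

lemma norm_le_spectral_norm: "norm (M *v v) \<le> spectral_norm M * norm v"
  unfolding spectral_norm_def by (rule onorm) simp

lemma spectral_norm_nonneg: "0 \<le> spectral_norm M"
  unfolding spectral_norm_def by (rule onorm_pos_le) simp

lemma spectral_norm_least:
  assumes "\<And>v. norm (M *v v) \<le> b * norm v"
  shows "spectral_norm M \<le> b"
  unfolding spectral_norm_def using assms by (rule onorm_le)

lemma inner_le_spectral_norm:
  assumes "norm u = 1" "norm v = 1"
  shows "u \<bullet> (M *v v) \<le> spectral_norm M"
  using norm_cauchy_schwarz[of u "M *v v"] norm_le_spectral_norm[of M v] assms by simp

lemma norm_transpose_le_spectral_norm:
  "norm (transpose M *v w) \<le> spectral_norm M * norm w"
proof (cases "transpose M *v w = 0")
  case False
  let ?y = "transpose M *v w"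
  have "norm ?y * norm ?y = ?y \<bullet> ?y"
    by (simp add: power2_norm_eq_inner[symmetric] power2_eq_square)
  also have "\<dots> = w \<bullet> (M *v ?y)"
    by (simp add: dot_lmul_matrix)
  also have "\<dots> \<le> norm w * (spectral_norm M * norm ?y)"
    by (meson norm_cauchy_schwarz norm_le_spectral_norm mult_left_mono norm_ge_zero order_trans)
  finally have "norm ?y * norm ?y \<le> (spectral_norm M * norm w) * norm ?y"
    by (simp add: mult_ac)
  then show ?thesis using False by simp
qed (simp add: spectral_norm_nonneg)

text \<open>
  Compactness of the unit sphere turns the supremum in the operator norm into a maximum.
  The maximizing vectors are the bridge between the norm and the singular values.
\<close>
lemma spectral_norm_attained:
  "\<exists>v. norm v = 1 \<and> norm (M *v v) = spectral_norm M"
proof -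
  obtain v where v: "v \<in> sphere 0 1" "\<And>w. w \<in> sphere 0 1 \<Longrightarrow> norm (M *v w) \<le> norm (M *v v)"
  proof -
    have "\<exists>v\<in>sphere 0 1. \<forall>w\<in>sphere 0 1. norm (M *v w) \<le> norm (M *v v)"
    proof (rule continuous_attains_sup)
      show "sphere (0::real^'n) 1 \<noteq> {}" using vector_choose_size[of 1] by (metis dist_0_norm mem_sphere empty_iff zero_le_one)
    qed (auto intro!: continuous_intros)
    then show ?thesis using that by blast
  qed
  have "norm (M *v w) \<le> norm (M *v v) * norm w" for w
  proof (cases "w = 0")
    case False
    have "norm (M *v (w /\<^sub>R norm w)) \<le> norm (M *v v)"
      using False by (intro v) (simp add: dist_norm)
    then show ?thesis using False by (simp add: matrix_vector_mult_scaleR field_simps)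
  qed simp
  then have "spectral_norm M \<le> norm (M *v v)" by (rule spectral_norm_least)
  then show ?thesis using v(1) norm_le_spectral_norm[of M v] by (intro exI[of _ v]) auto
qed

lemma spectral_norm_pos_iff: "0 < spectral_norm M \<longleftrightarrow> M \<noteq> 0"
proof -
  have "M = 0" if "spectral_norm M = 0"
    using norm_le_spectral_norm[of M] that by (simp add: matrix_eq)
  moreover have "spectral_norm (0 :: real ^ 'n ^ 'n) = 0"
    using spectral_norm_least[of "0 :: real ^ 'n ^ 'n" 0] spectral_norm_nonneg[of "0 :: real ^ 'n ^ 'n"] by simp
  ultimately show ?thesis using spectral_norm_nonneg[of M] by force
qed

lemma continuous_on_spectral_norm [continuous_intros]:
  fixes W :: "'a::topological_space \<Rightarrow> real ^ 'n ^ 'n"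
  assumes "continuous_on S W"
  shows "continuous_on S (\<lambda>t. spectral_norm (W t))"
proof -
  obtain B where B: "B > 0" "\<And>(M :: real ^ 'n ^ 'n) v. norm (M *v v) \<le> norm M * norm v * B"
    using bounded_bilinear.pos_bounded[OF bounded_bilinear_matrix_vector] by blast
  have le: "spectral_norm M \<le> spectral_norm L + B * norm (M - L)" for M L :: "real ^ 'n ^ 'n"
  proof (rule spectral_norm_least)
    fix v
    have "norm (M *v v) \<le> norm (L *v v) + norm ((M - L) *v v)"
      by (metis add.commute diff_add_cancel matrix_vector_mult_add_rdistrib norm_triangle_ineq)
    then show "norm (M *v v) \<le> (spectral_norm L + B * norm (M - L)) * norm v"
      using norm_le_spectral_norm[of L v] B(2)[of "M - L" v] by (simp add: algebra_simps)
  qed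
  have "B-lipschitz_on UNIV (spectral_norm :: real ^ 'n ^ 'n \<Rightarrow> real)"
    using B(1) le by (intro lipschitz_onI) (simp_all add: dist_norm abs_le_iff, smt (verit) norm_minus_commute)
  then have "continuous_on UNIV (spectral_norm :: real ^ 'n ^ 'n \<Rightarrow> real)"
    by (rule lipschitz_on_continuous_on)
  then show ?thesis using assms by (rule continuous_on_compose2) simp
qed

text \<open>
  Equality in the chain \<open>\<sigma>\<^sup>2 = (transpose M *v (M *v v)) \<bullet> v \<le> norm (transpose M *v (M *v v)) \<le> \<sigma>\<^sup>2\<close>
  forces \<open>transpose M *v (M *v v)\<close> to be the multiple \<open>\<sigma>\<^sup>2\<close> of \<open>v\<close>. Expanding the square of the
  distance between the two makes this quantitative.
\<close>
lemma maximizer_in_right_singular_space: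
  assumes v: "norm v = 1" "norm (M *v v) = spectral_norm M"
  shows "v \<in> right_singular_space M (spectral_norm M)"
proof -
  define s where "s = spectral_norm M"
  define y where "y = transpose M *v (M *v v)"
  have "y \<bullet> v = s\<^sup>2"
    unfolding y_def s_def v(2)[symmetric] power2_norm_eq_inner by (simp add: dot_lmul_matrix)
  moreover have "y \<bullet> y \<le> (s * s)\<^sup>2"
    unfolding power2_norm_eq_inner[symmetric]
    using norm_transpose_le_spectral_norm[of M "M *v v"] v by (intro power_mono) (auto simp: s_def y_def)
  moreover have "v \<bullet> v = 1" using v(1) by (simp add: norm_eq_1)
  moreover have "(norm (y - s\<^sup>2 *\<^sub>R v))\<^sup>2 = y \<bullet> y - 2 * s\<^sup>2 * (y \<bullet> v) + s\<^sup>2 * s\<^sup>2 * (v \<bullet> v)"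
    unfolding power2_norm_eq_inner by (simp add: algebra_simps inner_commute)
  ultimately have "(norm (y - s\<^sup>2 *\<^sub>R v))\<^sup>2 \<le> 0" by (simp add: power2_eq_square)
  then show ?thesis
    by (simp add: right_singular_space_def y_def s_def matrix_vector_mul_assoc)
qed

lemma singular_value_le_spectral_norm:
  assumes "singular_value M \<sigma>"
  shows "\<sigma> \<le> spectral_norm M"
proof -
  from assms obtain v where v: "0 \<le> \<sigma>" "v \<noteq> 0" "transpose M *v (M *v v) = \<sigma>\<^sup>2 *\<^sub>R v"
    by (auto simp: singular_value_def right_singular_space_def matrix_vector_mul_assoc)
  have "\<sigma>\<^sup>2 * norm v = norm (transpose M *v (M *v v))" unfolding v(3) by simp
  also have "\<dots> \<le> spectral_norm M * (spectral_norm M * norm v)"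
    by (meson norm_transpose_le_spectral_norm norm_le_spectral_norm mult_left_mono spectral_norm_nonneg order_trans)
  finally have "\<sigma>\<^sup>2 \<le> (spectral_norm M)\<^sup>2"
    using v(2) by (simp add: power2_eq_square)
  then show ?thesis using spectral_norm_nonneg by (rule power2_le_imp_le)
qed

lemma sigma_max_eq_spectral_norm: "sigma_max M = spectral_norm M"
  unfolding sigma_max_def
proof (rule Greatest_equality)
  obtain v where "norm v = 1" "norm (M *v v) = spectral_norm M"
    using spectral_norm_attained by blast
  then show "singular_value M (spectral_norm M)"
    unfolding singular_value_def using maximizer_in_right_singular_space spectral_norm_nonneg
    by (metis norm_zero zero_neq_one)
qed (rule singular_value_le_spectral_norm)

text \<open>
  Simplicity of the largest singular value enters here: both vectors lie in a line, so the
  maximizing direction is unique, so every derivative taken along a maximizer has the same value.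
\<close>
lemma maximizers_parallel:
  assumes simple: "simple_singular_value M (sigma_max M)"
    and v: "norm v = 1" "norm (M *v v) = spectral_norm M"
    and w: "norm w = 1" "norm (M *v w) = spectral_norm M"
  shows "w = v \<or> w = - v"
proof -
  let ?E = "right_singular_space M (spectral_norm M)"
  have "?E \<subseteq> span {v}"
    using simple maximizer_in_right_singular_space[OF v] v(1)
    by (intro card_ge_dim_independent)
       (auto simp: simple_singular_value_def sigma_max_eq_spectral_norm)
  then obtain a where a: "w = a *\<^sub>R v"
    using maximizer_in_right_singular_space[OF w] by (auto simp: span_singleton)
  then have "\<bar>a\<bar> = 1" using v(1) w(1) by simp
  then show ?thesis using a by (auto simp: abs_if split: if_splits)
qed

section \<open>Differentiability of the spectral norm along a curve of matrices\<close>

text \<open>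
  Danskin's envelope theorem: a maximum over a compact parameter set is differentiable at \<open>t\<close> as
  soon as all maximizers at time \<open>t\<close> agree on the time derivative. The increment of \<open>m\<close> is at least
  that of \<open>h\<close> at a fixed maximizer for \<open>t\<close>, and at most that of \<open>h\<close> at a maximizer for \<open>s\<close>. The
  latter is nearly maximal at time \<open>t\<close>, and by compactness nearly maximal parameters have a time
  derivative close to \<open>c\<close>.
\<close>
lemma envelope_has_real_derivative:
  fixes h :: "real \<Rightarrow> 'a::topological_space \<Rightarrow> real"
  assumes K: "compact K"
    and D: "continuous_on K D"
    and cont: "continuous_on K (h t)"
    and unif: "\<And>e. e > 0 \<Longrightarrow>
      \<forall>\<^sub>F s in at t within S. \<forall>v\<in>K. \<bar>h s v - h t v - (s - t) * D v\<bar> \<le> e * \<bar>s - t\<bar>"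
    and upper: "\<And>s v. s \<in> S \<Longrightarrow> v \<in> K \<Longrightarrow> h s v \<le> m s"
    and attained: "\<And>s. s \<in> S \<Longrightarrow> \<exists>v\<in>K. h s v = m s"
    and maximizers: "\<And>v. v \<in> K \<Longrightarrow> h t v = m t \<Longrightarrow> D v = c"
    and t: "t \<in> S"
  shows "(m has_real_derivative c) (at t within S)"
proof -
  obtain v0 where v0: "v0 \<in> K" "h t v0 = m t" using attained t by blast
  have Dv0: "D v0 = c" using maximizers v0 by blast
  obtain B where B: "B \<ge> 0" "\<And>v. v \<in> K \<Longrightarrow> \<bar>D v\<bar> \<le> B"
  proof -
    have "bounded (D ` K)" using K D by (intro compact_imp_bounded compact_continuous_image)
    then show ?thesis using that unfolding bounded_pos by (metis image_eqI less_eq_real_def real_norm_def)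
  qed
  have key: "\<forall>\<^sub>F s in at t within S. \<bar>m s - m t - (s - t) * c\<bar> \<le> e * \<bar>s - t\<bar>" if e: "e > 0" for e
  proof -
    \<comment> \<open>A gap below the maximum, on the compact set where the time derivative is not close to \<open>c\<close>.\<close>
    obtain \<eta> where \<eta>: "\<eta> > 0" "\<And>v. v \<in> K \<Longrightarrow> \<bar>D v - c\<bar> \<ge> e / 2 \<Longrightarrow> h t v \<le> m t - \<eta>"
    proof -
      let ?C = "{v \<in> K. e / 2 \<le> \<bar>D v - c\<bar>}"
      have "closedin (top_of_set K) (K \<inter> (\<lambda>v. \<bar>D v - c\<bar>) -` {e / 2..})"
        by (intro continuous_closedin_preimage) (auto intro!: continuous_intros D)
      moreover have "K \<inter> (\<lambda>v. \<bar>D v - c\<bar>) -` {e / 2..} = ?C" by auto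
      ultimately have C: "compact ?C" using K closedin_compact by metis
      show ?thesis
      proof (cases "?C = {}")
        case True
        then show ?thesis using that[of 1] by force
      next
        case False
        then obtain w where w: "w \<in> ?C" "\<And>v. v \<in> ?C \<Longrightarrow> h t v \<le> h t w"
          using continuous_attains_sup[OF C False, of "h t"] cont continuous_on_subset[of K "h t" ?C] by blast
        have "h t w \<noteq> m t" using w(1) maximizers[of w] e by auto
        then have "h t w < m t" using upper[OF t, of w] w(1) by auto
        then show ?thesis using w(2) by (intro that[of "m t - h t w"]) auto
      qed
    qed
    have "\<forall>\<^sub>F s in at t within S. \<bar>s - t\<bar> < \<eta> / (2 * (B + e))"
      unfolding eventually_at dist_real_def using \<eta> B e by (intro exI[of _ "\<eta> / (2 * (B + e))"]) auto
    moreover have "\<forall>\<^sub>F s in at t within S. s \<in> S" by (auto simp: eventually_at_topological)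
    moreover have "\<forall>\<^sub>F s in at t within S. \<forall>v\<in>K. \<bar>h s v - h t v - (s - t) * D v\<bar> \<le> e / 2 * \<bar>s - t\<bar>"
      using e by (intro unif) auto
    ultimately show ?thesis
    proof eventually_elim
      case (elim s)
      obtain v where v: "v \<in> K" "h s v = m s" using attained elim(2) by blast
      have small: "2 * (\<bar>s - t\<bar> * (B + e)) < \<eta>"
        using elim(1) B e by (simp add: field_simps)
      have incr: "\<bar>h s w - h t w\<bar> \<le> \<bar>s - t\<bar> * (B + e)" if "w \<in> K" for w
      proof -
        have "\<bar>(s - t) * D w\<bar> \<le> \<bar>s - t\<bar> * B" using B(2)[OF that] by (simp add: abs_mult mult_left_mono)
        moreover have "0 \<le> e / 2 * \<bar>s - t\<bar>" using e by simp
        moreover have "\<bar>h s w - h t w - (s - t) * D w\<bar> \<le> e / 2 * \<bar>s - t\<bar>" using elim(3) that by blast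
        moreover have "\<bar>s - t\<bar> * (B + e) = \<bar>s - t\<bar> * B + e / 2 * \<bar>s - t\<bar> + e / 2 * \<bar>s - t\<bar>"
          by (simp add: field_simps)
        ultimately show ?thesis by linarith
      qed
      \<comment> \<open>The maximizer \<open>v\<close> for \<open>s\<close> is within the gap at time \<open>t\<close>.\<close>
      have "h t v > m t - \<eta>"
        using incr[OF v(1)] incr[OF v0(1)] upper[OF elim(2) v0(1)] v v0 small by linarith
      then have "\<bar>D v - c\<bar> < e / 2" using \<eta>(2)[OF v(1)] by linarith
      then have "\<bar>s - t\<bar> * \<bar>D v - c\<bar> \<le> \<bar>s - t\<bar> * (e / 2)"
        by (intro mult_left_mono) auto
      then have Dv: "\<bar>(s - t) * D v - (s - t) * c\<bar> \<le> e / 2 * \<bar>s - t\<bar>"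
        by (simp add: abs_mult[symmetric] right_diff_distrib mult.commute)
      have "m s - m t - (s - t) * c \<ge> - (e / 2 * \<bar>s - t\<bar>)"
        using elim(3)[rule_format, OF v0(1)] upper[OF elim(2) v0(1)] unfolding v0(2) Dv0 by linarith
      moreover have "m s - m t - (s - t) * c \<le> e / 2 * \<bar>s - t\<bar> + e / 2 * \<bar>s - t\<bar>"
        using elim(3)[rule_format, OF v(1)] upper[OF t v(1)] v Dv by linarith
      moreover have "0 \<le> e / 2 * \<bar>s - t\<bar>" using e by simp
      ultimately show ?case by (simp add: abs_le_iff)
    qed
  qed
  show ?thesis
    unfolding has_field_derivative_def has_derivative_within_alt2
    using key by (auto simp: bounded_linear_mult_right mult.commute[of c])
qed

text \<open>
  The spectral norm is the maximum of the bilinear form \<open>u \<bullet> (M *v v)\<close> over pairs of unit vectors.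
  Maximizing this form, instead of \<open>norm (M *v v)\<close>, makes the objective linear in the matrix, so the
  uniform expansion required by the envelope theorem is that of the curve itself.
  Positivity excludes the kink at zero: for one-by-one matrices the norm is the absolute value.
\<close>
lemma spectral_norm_differentiable:
  fixes W :: "real \<Rightarrow> real ^ 'n ^ 'n"
  assumes W: "(W has_vector_derivative W') (at t within S)"
    and t: "t \<in> S"
    and simple: "simple_singular_value (W t) (sigma_max (W t))"
    and pos: "spectral_norm (W t) > 0"
  shows "\<exists>c. ((\<lambda>s. spectral_norm (W s)) has_real_derivative c) (at t within S)"
proof -
  define \<sigma> where "\<sigma> = spectral_norm (W t)"
  obtain v0 where v0: "norm v0 = 1" "norm (W t *v v0) = spectral_norm (W t)"
    using spectral_norm_attained by blast
  define h where "h s z = fst z \<bullet> (W s *v snd z)" for s z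
  define D where "D z = fst z \<bullet> (W' *v snd z)" for z
  define K where "K = sphere (0 :: real ^ 'n) 1 \<times> sphere (0 :: real ^ 'n) 1"
  define c where "c = ((1 / \<sigma>) *\<^sub>R (W t *v v0)) \<bullet> (W' *v v0)"
  obtain B where B: "B > 0" "\<And>(M :: real ^ 'n ^ 'n) v. norm (M *v v) \<le> norm M * norm v * B"
    using bounded_bilinear.pos_bounded[OF bounded_bilinear_matrix_vector] by blast
  have cont: "continuous_on K (\<lambda>z. fst z \<bullet> (M *v snd z))" for M :: "real ^ 'n ^ 'n"
    by (intro continuous_intros bounded_linear.continuous_on[OF matrix_vector_mul_bounded_linear])
  have "((\<lambda>s. spectral_norm (W s)) has_real_derivative c) (at t within S)"
  proof (rule envelope_has_real_derivative[where K = K and h = h and D = D])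
    show "compact K" unfolding K_def by (intro compact_Times compact_sphere)
    show "continuous_on K D" "continuous_on K (h t)"
      unfolding D_def h_def by (rule cont)+
    show "t \<in> S" by (rule t)
    show "h s z \<le> spectral_norm (W s)" if "z \<in> K" for s z
      using that by (auto simp: K_def h_def intro!: inner_le_spectral_norm)
  next
    fix e :: real assume e: "e > 0"
    then have "e / B > 0" using B by simp
    then have "\<forall>\<^sub>F s in at t within S. norm (W s - W t - (s - t) *\<^sub>R W') \<le> e / B * norm (s - t)"
      using W unfolding has_vector_derivative_def has_derivative_within_alt2 by blast
    then show "\<forall>\<^sub>F s in at t within S. \<forall>z\<in>K. \<bar>h s z - h t z - (s - t) * D z\<bar> \<le> e * \<bar>s - t\<bar>"
    proof eventually_elim
      case (elim s)
      show ?case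
      proof
        fix z assume "z \<in> K"
        then obtain u v where z: "z = (u, v)" "norm u = 1" "norm v = 1" by (auto simp: K_def)
        let ?R = "W s - W t - (s - t) *\<^sub>R W'"
        have "h s z - h t z - (s - t) * D z = u \<bullet> (?R *v v)"
          by (simp add: h_def D_def z algebra_simps scaleR_matrix_vector_assoc[symmetric])
        also have "\<bar>\<dots>\<bar> \<le> norm u * norm (?R *v v)" by (rule Cauchy_Schwarz_ineq2)
        also have "\<dots> \<le> norm ?R * B" using B(2)[of ?R v] z by simp
        also have "\<dots> \<le> e / B * norm (s - t) * B" using elim B by (intro mult_right_mono) auto
        finally show "\<bar>h s z - h t z - (s - t) * D z\<bar> \<le> e * \<bar>s - t\<bar>" using B by simp
      qed
    qed
  next
    fix s assume "s \<in> S"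
    obtain v where v: "norm v = 1" "norm (W s *v v) = spectral_norm (W s)"
      using spectral_norm_attained by blast
    show "\<exists>z\<in>K. h s z = spectral_norm (W s)"
    proof (cases "spectral_norm (W s) = 0")
      case True
      then have "W s *v v = 0" using v by simp
      then show ?thesis using v True by (intro bexI[of _ "(v, v)"]) (auto simp: h_def K_def)
    next
      case False
      let ?u = "(1 / spectral_norm (W s)) *\<^sub>R (W s *v v)"
      have "norm ?u = 1" using v False spectral_norm_nonneg[of "W s"] by simp
      moreover have "?u \<bullet> (W s *v v) = spectral_norm (W s)"
        using v False by (simp add: power2_norm_eq_inner[symmetric] power2_eq_square)
      ultimately show ?thesis using v by (intro bexI[of _ "(?u, v)"]) (auto simp: h_def K_def)
    qed
  next
    \<comment> \<open>The maximizing pairs are \<open>(u0, v0)\<close> and \<open>(- u0, - v0)\<close>, where \<open>u0 = W t *v v0 / \<sigma>\<close>; \<open>D\<close> is even.\<close>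
    fix z assume z: "z \<in> K" "h t z = spectral_norm (W t)"
    then obtain u v where uv: "z = (u, v)" "norm u = 1" "norm v = 1" "u \<bullet> (W t *v v) = \<sigma>"
      by (auto simp: K_def h_def \<sigma>_def)
    have nv: "norm (W t *v v) = \<sigma>"
      using norm_cauchy_schwarz[of u "W t *v v"] norm_le_spectral_norm[of "W t" v] uv
      by (simp add: \<sigma>_def)
    \<comment> \<open>Equality in the Cauchy-Schwarz inequality determines \<open>u\<close> from \<open>v\<close>.\<close>
    then have "norm u *\<^sub>R (W t *v v) = norm (W t *v v) *\<^sub>R u"
      using uv by (subst norm_cauchy_schwarz_eq[symmetric]) simp
    then have u: "u = (1 / \<sigma>) *\<^sub>R (W t *v v)" using nv uv pos by (simp add: \<sigma>_def)
    have "v = v0 \<or> v = - v0"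
      using maximizers_parallel[OF simple v0, of v] uv nv by (simp add: \<sigma>_def)
    then show "D z = c"
      unfolding D_def c_def uv(1) u by (auto simp: linear_neg[OF matrix_vector_mul_linear])
  qed
  then show ?thesis ..
qed

section \<open>Variation of parameters\<close>

lemma matrix_inv_cancel:
  fixes M :: "real ^ 'n ^ 'n"
  assumes "invertible M"
  shows "M ** matrix_inv M = mat 1" "matrix_inv M ** M = mat 1"
  using someI_ex[OF assms[unfolded invertible_def]] unfolding matrix_inv_def by auto

lemma spectral_norm_invertible_pos:
  fixes M :: "real ^ 'n ^ 'n"
  assumes "invertible M"
  shows "spectral_norm M > 0"
proof -
  have "M *v (matrix_inv M *v 1) = 1"
    using matrix_inv_cancel(1)[OF assms] by (simp add: matrix_vector_mul_assoc)
  then have "M \<noteq> 0" by auto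
  then show ?thesis by (simp add: spectral_norm_pos_iff)
qed

lemma continuous_on_det [continuous_intros]:
  fixes W :: "'a::topological_space \<Rightarrow> real ^ 'n ^ 'n"
  assumes "\<And>i j. continuous_on S (\<lambda>t. W t $ i $ j)"
  shows "continuous_on S (\<lambda>t. det (W t))"
  unfolding det_def by (intro continuous_intros assms)

text \<open>
  Cramer's rule writes the entries of the inverse as quotients of determinants.
\<close>
lemma continuous_on_matrix_inv:
  fixes W :: "'a::topological_space \<Rightarrow> real ^ 'n ^ 'n"
  assumes W: "continuous_on S W" and inv: "\<And>t. t \<in> S \<Longrightarrow> invertible (W t)"
  shows "continuous_on S (\<lambda>t. matrix_inv (W t))"
proof -
  let ?C = "\<lambda>t. \<chi> k j. det (\<chi> i l. if l = k then axis j 1 $ i else W t $ i $ l) / det (W t)"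
  have "matrix_inv (W t) = ?C t" if "t \<in> S" for t
  proof -
    have nz: "det (W t) \<noteq> 0" using inv[OF that] by (simp add: invertible_det_nz)
    have "W t *v (matrix_inv (W t) *v axis j 1) = axis j 1" for j
      using matrix_inv_cancel[OF inv[OF that]] by (simp add: matrix_vector_mul_assoc)
    then have "matrix_inv (W t) *v axis j 1
        = (\<chi> k. det (\<chi> i l. if l = k then axis j 1 $ i else W t $ i $ l) / det (W t))" for j
      using cramer[OF nz] by blast
    then show ?thesis by (simp add: vec_eq_iff matrix_vector_mul_component inner_axis matrix_vector_mult_basis column_def)
  qed
  moreover have "continuous_on S ?C"
  proof (intro continuous_on_vec_lambda continuous_on_divide continuous_on_det)
    show "continuous_on S (\<lambda>t. (\<chi> i l. if l = k then axis j 1 $ i else W t $ i $ l) $ i $ l)" for k j i l :: 'n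
      using W by (cases "l = k") (auto intro!: continuous_intros)
    show "continuous_on S (\<lambda>t. W t $ i $ j)" for i j
      using W by (intro continuous_intros)
    show "\<forall>t\<in>S. det (W t) \<noteq> 0" using inv by (simp add: invertible_det_nz)
  qed
  ultimately show ?thesis by (simp cong: continuous_on_cong)
qed

lemma has_vector_derivative_iff_slope:
  "(f has_vector_derivative D) (at t within S) \<longleftrightarrow>
     ((\<lambda>s. (f s - f t) /\<^sub>R (s - t)) \<longlongrightarrow> D) (at t within S)"
proof -
  have "norm (f s - f t - (s - t) *\<^sub>R D) / norm (s - t) = norm ((f s - f t) /\<^sub>R (s - t) - D)"
    if "s \<noteq> t" for s
  proof -
    have "f s - f t - (s - t) *\<^sub>R D = (s - t) *\<^sub>R ((f s - f t) /\<^sub>R (s - t) - D)"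
      unfolding scaleR_diff_right[of "s - t" _ D] scaleR_scaleR using that by simp
    then have "norm (f s - f t - (s - t) *\<^sub>R D) = norm (s - t) * norm ((f s - f t) /\<^sub>R (s - t) - D)"
      by (simp only: norm_scaleR real_norm_def)
    then show ?thesis using that by simp
  qed
  then have "((\<lambda>s. norm (f s - f t - (s - t) *\<^sub>R D) / norm (s - t)) \<longlongrightarrow> 0) (at t within S) \<longleftrightarrow>
      ((\<lambda>s. norm ((f s - f t) /\<^sub>R (s - t) - D)) \<longlongrightarrow> 0) (at t within S)"
    by (intro Lim_cong_within) auto
  then show ?thesis
    by (simp add: has_vector_derivative_def has_derivative_iff_norm bounded_linear_scaleR_left
        tendsto_norm_zero_iff LIM_zero_iff)
qed

text \<open>
  The difference quotient of \<open>matrix_inv (W s) *v x s\<close> is \<open>matrix_inv (W s)\<close> applied to that of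
  \<open>d s = x s - W s *v (matrix_inv (W t) *v x t)\<close>. As \<open>d\<close> vanishes at \<open>t\<close> and has derivative \<open>g\<close> there,
  continuity of the inverse lets the limit pass through.
\<close>
lemma variation_of_parameters:
  fixes W :: "real \<Rightarrow> real ^ 'n ^ 'n"
  assumes W: "\<And>s. s \<in> S \<Longrightarrow> (W has_vector_derivative A s ** W s) (at s within S)"
    and inv: "\<And>s. s \<in> S \<Longrightarrow> invertible (W s)"
    and x: "(x has_vector_derivative A t *v x t + g) (at t within S)"
    and t: "t \<in> S"
  shows "((\<lambda>s. matrix_inv (W s) *v x s) has_vector_derivative matrix_inv (W t) *v g) (at t within S)"
proof -
  let ?V = "\<lambda>s. matrix_inv (W s)"
  let ?z = "?V t *v x t"
  define d where "d s = x s - W s *v ?z" for s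
  have VW: "?V s *v (W s *v v) = v" "W s *v (?V s *v v) = v" if "s \<in> S" for s v
    using matrix_inv_cancel[OF inv[OF that]] by (simp_all add: matrix_vector_mul_assoc)
  have "continuous_on S ?V"
    using W inv by (intro continuous_on_matrix_inv continuous_on_vector_derivative) 
  then have V: "(?V \<longlongrightarrow> ?V t) (at t within S)" using t by (simp add: continuous_on_def)
  have "((\<lambda>s. W s *v ?z) has_vector_derivative (A t ** W t) *v ?z) (at t within S)"
    by (rule bounded_linear.has_vector_derivative
        [OF bounded_bilinear.bounded_linear_left[OF bounded_bilinear_matrix_vector] W[OF t]])
  moreover have "(A t ** W t) *v ?z = A t *v x t"
    by (simp add: matrix_vector_mul_assoc[symmetric] VW t)
  ultimately have "(d has_vector_derivative g) (at t within S)"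
    unfolding d_def using has_vector_derivative_diff[OF x] by fastforce
  moreover have "d t = 0" by (simp add: d_def VW t)
  ultimately have "((\<lambda>s. d s /\<^sub>R (s - t)) \<longlongrightarrow> g) (at t within S)"
    unfolding has_vector_derivative_iff_slope by simp
  then have "((\<lambda>s. ?V s *v (d s /\<^sub>R (s - t))) \<longlongrightarrow> ?V t *v g) (at t within S)"
    using V by (intro bounded_bilinear.tendsto[OF bounded_bilinear_matrix_vector])
  then show ?thesis
    unfolding has_vector_derivative_iff_slope
  proof (rule Lim_transform_within[OF _ zero_less_one])
    fix s assume "s \<in> S"
    then have "?V s *v d s = ?V s *v x s - ?V t *v x t"
      by (simp add: d_def VW matrix_vector_mult_diff_distrib)
    then show "?V s *v (d s /\<^sub>R (s - t)) = (?V s *v x s - ?V t *v x t) /\<^sub>R (s - t)"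
      by (simp add: matrix_vector_mult_scaleR)
  qed
qed

text \<open>
  The scalar \<open>u\<close> bounds the norm of \<open>matrix_inv (W s) *v x s\<close>: it has the same initial value and is the
  integral of an upper bound for the growth rate of that norm. It replaces the norm, which need not be differentiable
  where it vanishes, by a function with a genuine derivative and a linear differential inequality.
\<close>
lemma variation_of_parameters_majorant:
  fixes W :: "real \<Rightarrow> real ^ 'n ^ 'n"
  assumes W: "\<And>s. s \<in> {a..T} \<Longrightarrow> (W has_vector_derivative A s ** W s) (at s within {a..T})"
    and inv: "\<And>s. s \<in> {a..T} \<Longrightarrow> invertible (W s)"
    and x: "\<And>s. s \<in> {a..T} \<Longrightarrow> (x has_vector_derivative A s *v x s + g s) (at s within {a..T})"
    and l: "continuous_on {a..T} l" "\<And>s. s \<in> {a..T} \<Longrightarrow> 0 \<le> l s"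
    and g: "\<And>s. s \<in> {a..T} \<Longrightarrow> norm (g s) \<le> l s * norm (x s) + F"
  obtains u u' where "u a = norm (matrix_inv (W a) *v x a)"
    "\<And>s. s \<in> {a..T} \<Longrightarrow> (u has_real_derivative u' s) (at s within {a..T})"
    "\<And>s. s \<in> {a..T} \<Longrightarrow> u' s \<le> spectral_norm (matrix_inv (W s)) * (l s * (spectral_norm (W s) * u s) + F)"
    "\<And>s. s \<in> {a..T} \<Longrightarrow> norm (x s) \<le> spectral_norm (W s) * u s"
proof -
  let ?V = "\<lambda>s. matrix_inv (W s)"
  define z where "z s = ?V s *v x s" for s
  define u' where "u' s = spectral_norm (?V s) * (l s * norm (x s) + F)" for s
  define u where "u s = norm (z a) + integral {a..s} u'" for s
  have x_cont: "continuous_on {a..T} x" using x by (rule continuous_on_vector_derivative)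
  have W_cont: "continuous_on {a..T} W" using W by (rule continuous_on_vector_derivative)
  have u'_cont: "continuous_on {a..T} u'"
    unfolding u'_def using W_cont inv x_cont l(1)
    by (intro continuous_intros continuous_on_matrix_inv) auto
  have u: "(u has_real_derivative u' s) (at s within {a..T})" if "s \<in> {a..T}" for s
    unfolding u_def using integral_has_real_derivative[OF u'_cont that]
    by (auto intro!: derivative_eq_intros)
  have z: "(z has_vector_derivative ?V s *v g s) (at s within {a..T})" if "s \<in> {a..T}" for s
    unfolding z_def by (rule variation_of_parameters[where A = A]) (use W inv x that in auto)
  have z_le: "norm (z s) \<le> u s" if s: "s \<in> {a..T}" for s
  proof (cases "s = a")
    case False
    then have "a < s" using s by auto
    moreover have "continuous_on {a..s} z" "continuous_on {a..s} u"
      using continuous_on_vector_derivative[OF z] DERIV_continuous_on[OF u] s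
      by (auto intro: continuous_on_subset)
    ultimately have "norm (z s - z a) \<le> u s - u a"
    proof (rule differentiable_bound_general)
      fix r assume r: "a < r" "r < s"
      then have ri: "r \<in> {a..T}" "a < r" "r < T" using s by auto
      show "(z has_vector_derivative ?V r *v g r) (at r)"
        using z[OF ri(1)] ri by (simp add: at_within_Icc_at)
      show "(u has_vector_derivative u' r) (at r)"
        using u[OF ri(1)] ri by (simp add: at_within_Icc_at has_real_derivative_iff_has_vector_derivative)
      have "norm (?V r *v g r) \<le> spectral_norm (?V r) * norm (g r)" by (rule norm_le_spectral_norm)
      also have "\<dots> \<le> u' r"
        unfolding u'_def using g[OF ri(1)] by (intro mult_left_mono spectral_norm_nonneg)
      finally show "norm (?V r *v g r) \<le> u' r" .
    qed
    then show ?thesis using norm_triangle_sub[of "z s" "z a"] by (simp add: u_def)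
  qed (simp add: u_def)
  have x_le: "norm (x s) \<le> spectral_norm (W s) * u s" if s: "s \<in> {a..T}" for s
  proof -
    have "x s = W s *v z s"
      using matrix_inv_cancel(1)[OF inv[OF s]] by (simp add: z_def matrix_vector_mul_assoc)
    then have "norm (x s) \<le> spectral_norm (W s) * norm (z s)" by (simp add: norm_le_spectral_norm)
    also have "\<dots> \<le> spectral_norm (W s) * u s" by (intro mult_left_mono z_le s spectral_norm_nonneg)
    finally show ?thesis .
  qed
  show ?thesis
  proof (rule that[of u u'])
    show "u a = norm (?V a *v x a)" by (simp add: u_def z_def)
    show "u' s \<le> spectral_norm (?V s) * (l s * (spectral_norm (W s) * u s) + F)" if "s \<in> {a..T}" for s
      unfolding u'_def by (intro mult_left_mono add_right_mono x_le spectral_norm_nonneg l that)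
  qed (use u x_le in auto)
qed

section \<open>Differential inequalities\<close>

text \<open>
  The function \<open>exp (a * (s - c)) * (y s - b / a)\<close> is nonincreasing. Both signs of \<open>a\<close> are used: a
  negative one gives growth bounds on a compact interval, a positive one gives decay.
\<close>
lemma linear_comparison:
  fixes y y' :: "real \<Rightarrow> real"
  assumes der: "\<And>s. s \<in> {c..d} \<Longrightarrow> (y has_real_derivative y' s) (at s within {c..d})"
    and le: "\<And>s. s \<in> {c..d} \<Longrightarrow> y' s \<le> - a * y s + b"
    and a: "a \<noteq> 0" and cd: "c \<le> d"
  shows "y d \<le> b / a + exp (- a * (d - c)) * (y c - b / a)"
proof -
  define w where "w s = exp (a * (s - c)) * (y s - b / a)" for s
  have der_w: "(w has_real_derivative exp (a * (s - c)) * (a * y s - b + y' s)) (at s within {c..d})"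
    if "s \<in> {c..d}" for s
    unfolding w_def using a
    by (auto intro!: derivative_eq_intros der that simp: algebra_simps)
  have "w d \<le> w c"
  proof (rule DERIV_nonpos_imp_decreasing_open[OF cd])
    fix s assume s: "c < s" "s < d"
    have "(w has_real_derivative exp (a * (s - c)) * (a * y s - b + y' s)) (at s)"
      using der_w[of s] s by (simp add: at_within_Icc_at)
    moreover have "exp (a * (s - c)) * (a * y s - b + y' s) \<le> 0"
      using le[of s] s by (intro mult_nonneg_nonpos) auto
    ultimately show "\<exists>y. (w has_real_derivative y) (at s) \<and> y \<le> 0" by blast
  qed (rule DERIV_continuous_on[OF der_w])
  then have "exp (- a * (d - c)) * w d \<le> exp (- a * (d - c)) * w c"
    by (intro mult_left_mono) auto
  moreover have "exp (- a * (d - c)) * w d = y d - b / a"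
    by (simp add: w_def exp_minus)
  moreover have "w c = y c - b / a" by (simp add: w_def)
  ultimately have "y d - b / a \<le> exp (- a * (d - c)) * (y c - b / a)" by (simp only:)
  then show ?thesis by simp
qed

text \<open>
  Continuous induction: an estimate that is valid while the curve lies in a closed ball, and that is
  strictly better than membership in it, rules out a first time of contact with the sphere.
\<close>
lemma confined_by_strict_bound:
  fixes x :: "real \<Rightarrow> 'a::real_normed_vector"
  assumes cont: "continuous_on {c..} x" and start: "norm (x c) < \<rho>"
    and improve: "\<And>T. T \<ge> c \<Longrightarrow> (\<And>s. s \<in> {c..T} \<Longrightarrow> norm (x s) \<le> \<rho>) \<Longrightarrow> norm (x T) < \<rho>"
    and t: "t \<ge> c"
  shows "norm (x t) < \<rho>"
proof (rule ccontr)
  assume "\<not> norm (x t) < \<rho>"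
  then have big: "norm (x t) \<ge> \<rho>" by simp
  let ?E = "{s \<in> {c..t}. norm (x s) \<in> {\<rho>..}}"
  have ct: "continuous_on {c..t} (\<lambda>s. norm (x s))"
    using cont by (intro continuous_intros) (auto intro: continuous_on_subset)
  have "closed ({c..t} \<inter> (\<lambda>s. norm (x s)) -` {\<rho>..})"
    by (rule continuous_closed_preimage[OF ct]) auto
  moreover have "{c..t} \<inter> (\<lambda>s. norm (x s)) -` {\<rho>..} = ?E" by auto
  ultimately have "closed ?E" by simp
  moreover have "?E \<noteq> {}" using big t by auto
  moreover have bb: "bdd_below ?E" by (rule bdd_belowI[of _ c]) auto
  ultimately have T: "Inf ?E \<in> ?E" by (intro closed_contains_Inf)
  define T where "T = Inf ?E"
  have T_in: "c \<le> T" "T \<le> t" "norm (x T) \<ge> \<rho>" using T by (auto simp: T_def)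
  have before: "norm (x s) < \<rho>" if "s \<in> {c..<T}" for s
  proof (rule ccontr)
    assume "\<not> norm (x s) < \<rho>"
    then have "s \<in> ?E" using that T_in by auto
    then have "T \<le> s" unfolding T_def using bb by (rule cInf_lower)
    then show False using that by simp
  qed
  have "continuous_on {c..T} (\<lambda>s. norm (x s))"
    using T_in by (intro continuous_on_subset[OF ct]) auto
  then obtain s where s: "c \<le> s" "s \<le> T" "norm (x s) = \<rho>"
    using IVT'[of "\<lambda>s. norm (x s)" c \<rho> T] start T_in by auto
  then have "s = T" using before[of s] by force
  then have "norm (x r) \<le> \<rho>" if "r \<in> {c..T}" for r
    using before[of r] s that by (cases "r = T") auto
  then have "norm (x T) < \<rho>" using T_in by (intro improve)
  then show False using T_in by simp
qed

section \<open>Estimates for perturbed linear equations\<close>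

lemma fundamental_matrixD:
  assumes "fundamental_matrix A a W" "s \<in> I" "I \<subseteq> {a..}"
  shows "(W has_vector_derivative A s ** W s) (at s within I)" "invertible (W s)"
  using assms
  by (auto simp: fundamental_matrix_def ode_solution_def intro: has_vector_derivative_within_subset)

text \<open>
  The rate is defined through a choice operator, so it carries information only because the
  logarithm of the norm is differentiable.
\<close>
lemma spectral_norm_has_log_norm_rate:
  fixes W :: "real \<Rightarrow> real ^ 'n ^ 'n"
  assumes W: "fundamental_matrix A a W" and s: "s \<ge> a"
    and simple: "simple_singular_value (W s) (sigma_max (W s))"
  shows "((\<lambda>s. spectral_norm (W s)) has_real_derivative log_norm_rate a W s * spectral_norm (W s))
    (at s within {a..})"
proof -
  have pos: "spectral_norm (W s) > 0"
    using fundamental_matrixD(2)[OF W, of s "{a..}"] s by (intro spectral_norm_invertible_pos) auto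
  obtain d where d: "((\<lambda>s. spectral_norm (W s)) has_real_derivative d) (at s within {a..})"
    using spectral_norm_differentiable[OF fundamental_matrixD(1)[OF W, of s "{a..}"] _ simple pos] s
    by auto
  have "((\<lambda>s. ln (spectral_norm (W s))) has_real_derivative d / spectral_norm (W s)) (at s within {a..})"
    using pos by (auto intro!: derivative_eq_intros d)
  moreover have "at s within {a..} \<noteq> bot"
  proof -
    have "at_right s \<le> at s within {a..}" using s by (intro at_le) auto
    then show ?thesis using trivial_limit_at_right_real[of s] by (metis bot.extremum_uniqueI)
  qed
  ultimately have "log_norm_rate a W s = d / spectral_norm (W s)"
    unfolding log_norm_rate_def has_real_derivative_iff_has_vector_derivative
    by (rule vector_derivative_within[rotated])
  then show ?thesis using d pos by simp
qed

text \<open>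
  Let \<open>u\<close> be the majorant. Up to time \<open>c\<close> the rate may be positive, and Gronwall's inequality with constants from compactness controls \<open>u\<close>. From \<open>c\<close> on, \<open>y = spectral_norm (W s) * u s\<close>
  bounds the solution and satisfies
  \<open>y' \<le> (p + k * l) * y + k * F \<le> - \<nu> * y + b\<close>, where \<open>k\<close> is the condition number.
  The constant \<open>C\<close> is chosen before \<open>x\<close>, \<open>g\<close>, \<open>F\<close> and \<open>T\<close>, so that smallness of the data can be prescribed
  in terms of it. The separate bound \<open>b\<close> allows \<open>F = 0\<close>, \<open>b = 0\<close> when the condition number is unbounded.
\<close>
lemma perturbed_solution_bound:
  fixes W :: "real \<Rightarrow> real ^ 'n ^ 'n"
  assumes W: "fundamental_matrix A a W"
    and l: "continuous_on {a..} l" "\<And>s. s \<ge> a \<Longrightarrow> 0 \<le> l s"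
    and c: "a \<le> c"
    and p: "\<And>s. s \<ge> c \<Longrightarrow>
      ((\<lambda>s. spectral_norm (W s)) has_real_derivative p s * spectral_norm (W s)) (at s within {a..})"
    and rate: "\<And>s. s \<ge> c \<Longrightarrow> p s + condition_number (W s) * l s \<le> - \<nu>"
    and \<nu>: "\<nu> > 0"
  obtains C where "C > 0"
    "\<And>x g T F b.
       (\<And>s. s \<ge> a \<Longrightarrow> (x has_vector_derivative A s *v x s + g s) (at s within {a..})) \<Longrightarrow>
       (\<And>s. s \<in> {a..T} \<Longrightarrow> norm (g s) \<le> l s * norm (x s) + F) \<Longrightarrow> 0 \<le> F \<Longrightarrow>
       (\<And>s. s \<ge> c \<Longrightarrow> condition_number (W s) * F \<le> b) \<Longrightarrow> c \<le> T \<Longrightarrow>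
       (\<forall>s\<in>{a..c}. norm (x s) \<le> C * (norm (x a) + F)) \<and>
       norm (x T) \<le> b / \<nu> + exp (- \<nu> * (T - c)) * (C * (norm (x a) + F))"
proof -
  let ?V = "\<lambda>s. matrix_inv (W s)"
  have WD: "(W has_vector_derivative A s ** W s) (at s within I)" "invertible (W s)"
    if "s \<in> I" "I \<subseteq> {a..}" for s I
    using fundamental_matrixD[OF W that] by auto
  have W_cont: "continuous_on {a..c} W"
    by (rule continuous_on_vector_derivative[OF WD(1)]) auto
  have V_cont: "continuous_on {a..c} ?V"
    using WD(2)[of _ "{a..}"] by (intro continuous_on_matrix_inv W_cont) auto
  have upper: "\<exists>B\<ge>1. \<forall>s\<in>{a..c}. q s \<le> B" if q: "continuous_on {a..c} q" for q :: "real \<Rightarrow> real"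
  proof -
    obtain m where "m \<in> {a..c}" "\<forall>s\<in>{a..c}. q s \<le> q m"
      using continuous_attains_sup[OF compact_Icc _ q] c by fastforce
    then show ?thesis by (intro exI[of _ "max 1 (q m)"]) auto
  qed
  obtain K where K: "K \<ge> 1"
    "\<And>s. s \<in> {a..c} \<Longrightarrow> spectral_norm (?V s) * (l s * spectral_norm (W s)) \<le> K"
  proof -
    have "continuous_on {a..c} (\<lambda>s. spectral_norm (?V s) * (l s * spectral_norm (W s)))"
      using l(1) by (intro continuous_intros W_cont V_cont) (auto intro: continuous_on_subset)
    then show ?thesis using that upper by blast
  qed
  obtain B where B: "B \<ge> 1" "\<And>s. s \<in> {a..c} \<Longrightarrow> spectral_norm (?V s) \<le> B"
    using upper[OF continuous_on_spectral_norm[OF V_cont]] by blast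
  obtain M where M: "M \<ge> 1" "\<And>s. s \<in> {a..c} \<Longrightarrow> spectral_norm (W s) \<le> M"
    using upper[OF continuous_on_spectral_norm[OF W_cont]] by blast
  define C where "C = M * (exp (K * (c - a)) * B)"
  have "C > 0" using M B by (simp add: C_def)
  moreover have "(\<forall>s\<in>{a..c}. norm (x s) \<le> C * (norm (x a) + F)) \<and>
       norm (x T) \<le> b / \<nu> + exp (- \<nu> * (T - c)) * (C * (norm (x a) + F))"
    if x: "\<And>s. s \<ge> a \<Longrightarrow> (x has_vector_derivative A s *v x s + g s) (at s within {a..})"
      and g: "\<And>s. s \<in> {a..T} \<Longrightarrow> norm (g s) \<le> l s * norm (x s) + F" and F: "0 \<le> F"
      and b: "\<And>s. s \<ge> c \<Longrightarrow> condition_number (W s) * F \<le> b" and T: "c \<le> T" for x g T F b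
  proof -
    define G where "G = norm (x a) + F"
    have sub: "{a..T} \<subseteq> {a..}" by auto
    obtain u u' where u: "u a = norm (?V a *v x a)"
      "\<And>s. s \<in> {a..T} \<Longrightarrow> (u has_real_derivative u' s) (at s within {a..T})"
      "\<And>s. s \<in> {a..T} \<Longrightarrow> u' s \<le> spectral_norm (?V s) * (l s * (spectral_norm (W s) * u s) + F)"
      "\<And>s. s \<in> {a..T} \<Longrightarrow> norm (x s) \<le> spectral_norm (W s) * u s"
    proof (rule variation_of_parameters_majorant[where W = W and a = a and T = T and A = A and x = x
          and g = g and l = l and F = F])
      show "(x has_vector_derivative A s *v x s + g s) (at s within {a..T})" if "s \<in> {a..T}" for s
        using that by (intro has_vector_derivative_within_subset[OF x sub]) simp
      show "continuous_on {a..T} l" using l(1) sub by (rule continuous_on_subset)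
      show "(W has_vector_derivative A s ** W s) (at s within {a..T})" "invertible (W s)" "0 \<le> l s"
        "norm (g s) \<le> l s * norm (x s) + F" if "s \<in> {a..T}" for s
        using WD[OF that sub] l(2) g that by auto
    qed (use that in blast)
    have u_nonneg: "0 \<le> u s" if "s \<in> {a..T}" for s
    proof -
      have "spectral_norm (W s) > 0"
        using WD(2)[OF that sub] by (rule spectral_norm_invertible_pos)
      then show ?thesis
        using order_trans[OF norm_ge_zero u(4)[OF that]] by (simp add: zero_le_mult_iff)
    qed
    have early: "spectral_norm (W s) * u s \<le> C * G" if s: "s \<in> {a..c}" for s
    proof -
      \<comment> \<open>Gronwall's inequality, as comparison with negative decay rate \<open>- K\<close>.\<close>
      have "u s \<le> (B * F) / (- K) + exp (- (- K) * (s - a)) * (u a - (B * F) / (- K))"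
      proof (rule linear_comparison)
        fix r assume r: "r \<in> {a..s}"
        then have r': "r \<in> {a..T}" "r \<in> {a..c}" using s T by auto
        show "(u has_real_derivative u' r) (at r within {a..s})"
          by (rule has_field_derivative_subset[OF u(2)[OF r'(1)]]) (use s T in auto)
        have "u' r \<le> (spectral_norm (?V r) * (l r * spectral_norm (W r))) * u r + spectral_norm (?V r) * F"
          using u(3)[OF r'(1)] by (simp add: algebra_simps)
        also have "\<dots> \<le> K * u r + B * F"
          by (intro add_mono mult_right_mono K B r' u_nonneg F)
        finally show "u' r \<le> - (- K) * u r + B * F" by simp
      qed (use K s in auto)
      also have "\<dots> \<le> exp (K * (s - a)) * (u a + B * F / K)"
        using B K F by simp
      also have "\<dots> \<le> exp (K * (c - a)) * (B * norm (x a) + B * F)"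
      proof (intro mult_mono add_mono)
        have "u a \<le> spectral_norm (?V a) * norm (x a)" unfolding u(1) by (rule norm_le_spectral_norm)
        also have "\<dots> \<le> B * norm (x a)" using B(2)[of a] c by (intro mult_right_mono) auto
        finally show "u a \<le> B * norm (x a)" .
        have "B * F * 1 \<le> B * F * K" using K B F by (intro mult_left_mono) auto
        then show "B * F / K \<le> B * F" using K by (simp add: divide_le_eq)
        show "0 \<le> u a + B * F / K" using u(1) B K F by simp
      qed (use s K in auto)
      finally have "u s \<le> exp (K * (c - a)) * B * G" by (simp add: G_def algebra_simps)
      then have "spectral_norm (W s) * u s \<le> M * (exp (K * (c - a)) * B * G)"
        using M s T u_nonneg[of s] by (intro mult_mono) auto
      then show ?thesis by (simp add: C_def algebra_simps)
    qed
    have "spectral_norm (W T) * u T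
        \<le> b / \<nu> + exp (- \<nu> * (T - c)) * (spectral_norm (W c) * u c - b / \<nu>)"
    proof (rule linear_comparison)
      fix s assume s: "s \<in> {c..T}"
      then have s': "s \<in> {a..T}" "s \<ge> c" using c by auto
      let ?n = "spectral_norm (W s)"
      show "((\<lambda>s. spectral_norm (W s) * u s) has_real_derivative p s * ?n * u s + u' s * ?n)
          (at s within {c..T})"
        by (rule DERIV_mult'[THEN DERIV_cong, OF has_field_derivative_subset[OF p[OF s'(2)]]
              has_field_derivative_subset[OF u(2)[OF s'(1)]]])
          (use c in \<open>auto simp: algebra_simps\<close>)
      have "p s * ?n * u s + u' s * ?n
          \<le> p s * ?n * u s + spectral_norm (?V s) * (l s * (?n * u s) + F) * ?n"
        by (intro add_left_mono mult_right_mono u(3) s' spectral_norm_nonneg)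
      also have "\<dots> = (p s + condition_number (W s) * l s) * (?n * u s) + condition_number (W s) * F"
        by (simp add: condition_number_def algebra_simps)
      also have "\<dots> \<le> - \<nu> * (?n * u s) + b"
        by (intro add_mono mult_right_mono rate b s' mult_nonneg_nonneg u_nonneg spectral_norm_nonneg)
      finally show "p s * ?n * u s + u' s * ?n \<le> - \<nu> * (?n * u s) + b" .
    qed (use \<nu> T in auto)
    also have "\<dots> \<le> b / \<nu> + exp (- \<nu> * (T - c)) * (C * G)"
    proof -
      have "0 \<le> condition_number (W c) * F"
        using F by (simp add: condition_number_def spectral_norm_nonneg)
      then have "0 \<le> b / \<nu>" using b[of c] \<nu> by simp
      moreover have "spectral_norm (W c) * u c \<le> C * G" using early[of c] c by simp
      ultimately have "spectral_norm (W c) * u c - b / \<nu> \<le> C * G" by linarith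
      then show ?thesis by (intro add_left_mono mult_left_mono) auto
    qed
    finally have "norm (x T) \<le> b / \<nu> + exp (- \<nu> * (T - c)) * (C * G)"
      using u(4)[of T] c T by (simp add: order_trans)
    moreover have "norm (x s) \<le> C * G" if "s \<in> {a..c}" for s
      using early[OF that] u(4)[of s] that T by (auto intro: order_trans)
    ultimately show ?thesis by (simp add: G_def)
  qed
  ultimately show ?thesis using that by blast
qed

section \<open>Stability\<close>

theorem corollary2:
  fixes \<tau> t0 t1 t_star \<delta>1 \<nu> l_hat F_max :: real
    and A W :: "real \<Rightarrow> real ^ 'n ^ 'n"
    and f :: "real \<Rightarrow> real ^ 'n \<Rightarrow> real ^ 'n"
    and \<phi> :: "real \<Rightarrow> real ^ 'n"
    and l p k :: "real \<Rightarrow> real"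
    and \<Omega>1 N :: "(real ^ 'n) set"
    and x :: "real \<Rightarrow> real ^ 'n \<Rightarrow> real \<Rightarrow> real ^ 'n"
  assumes p: "p = log_norm_rate t0 W"
    and k: "k = (\<lambda>t. condition_number (W t))"
    and t0: "t0 \<in> {\<tau>..}"
    and A_cont: "continuous_on {t0..} A"
    and f_cont: "continuous_on ({t0..} \<times> UNIV) (\<lambda>(t, v). f t v)"
    and f_zero: "\<And>t. t \<ge> t0 \<Longrightarrow> f t 0 = 0"
    and \<phi>_cont: "continuous_on {t0..} \<phi>"
    and \<phi>_norm: "\<And>t. t \<ge> t0 \<Longrightarrow> norm (\<phi> t) = 1"
    and N_nhd: "0 \<in> interior N"
    and F_max: "F_max > 0"
    and solution: "\<And>F_hat x0. 0 \<le> F_hat \<Longrightarrow> F_hat \<le> F_max \<Longrightarrow> x0 \<in> N \<Longrightarrow>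
           unique_solution (\<lambda>t v. A t *v v + f t v + F_hat *\<^sub>R \<phi> t) t0 x0 (x F_hat x0)"
    and W: "fundamental_matrix A t0 W"
    and W_norm: "spectral_norm (W t0) = 1"
    and simple: "\<And>t. t \<ge> t0 \<Longrightarrow> simple_singular_value (W t) (sigma_max (W t))"
    and \<Omega>1_nhd: "bounded \<Omega>1" "0 \<in> interior \<Omega>1"
    and l_cont: "continuous_on {t0..} l"
    and l_bound: "\<And>t. t \<ge> t0 \<Longrightarrow> 0 < l t \<and> l t \<le> l_hat"
    and f_bound: "\<And>t v. t \<ge> t0 \<Longrightarrow> v \<in> \<Omega>1 \<Longrightarrow> norm (f t v) \<le> l t * norm v"
    and t1: "\<delta>1 > 0" "t1 = t0 + \<delta>1"
    and stays: "\<exists>\<epsilon>>0. \<forall>F_hat x0. 0 \<le> F_hat \<and> F_hat < \<epsilon> \<and> norm x0 < \<epsilon> \<longrightarrow>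
           (\<forall>t\<in>{t0..t1}. x F_hat x0 t \<in> \<Omega>1)"
    and t_star: "t0 \<le> t_star" "t_star < t1"
    and \<nu>: "\<nu> > 0"
    and sup: "(SUP t\<in>{t_star..}. ereal (p t + k t * l t)) \<le> ereal (- \<nu>)"
  shows "exponentially_stable (\<lambda>t v. A t *v v + f t v) t0 \<and>
    (\<forall>k_hat. (SUP t\<in>{t0..}. ereal (k t)) = ereal k_hat \<longrightarrow>
      (\<exists>\<epsilon>>0. \<forall>F_hat x0. 0 \<le> F_hat \<and> F_hat < \<epsilon> \<and> norm x0 < \<epsilon> \<longrightarrow>
         bounded (x F_hat x0 ` {t0..}) \<and>
         Limsup at_top (\<lambda>t. ereal (norm (x F_hat x0 t))) \<le> ereal (F_hat * k_hat / \<nu>)))"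
proof -
  have rate: "p s + k s * l s \<le> - \<nu>" if "s \<ge> t_star" for s
    using order_trans[OF SUP_upper[of s "{t_star..}" "\<lambda>t. ereal (p t + k t * l t)"] sup] that by simp
  obtain C where C: "C > 0"
    "\<And>x g T F b.
       (\<And>s. s \<ge> t0 \<Longrightarrow> (x has_vector_derivative A s *v x s + g s) (at s within {t0..})) \<Longrightarrow>
       (\<And>s. s \<in> {t0..T} \<Longrightarrow> norm (g s) \<le> l s * norm (x s) + F) \<Longrightarrow> 0 \<le> F \<Longrightarrow>
       (\<And>s. s \<ge> t_star \<Longrightarrow> k s * F \<le> b) \<Longrightarrow> t_star \<le> T \<Longrightarrow>
       (\<forall>s\<in>{t0..t_star}. norm (x s) \<le> C * (norm (x t0) + F)) \<and>
       norm (x T) \<le> b / \<nu> + exp (- \<nu> * (T - t_star)) * (C * (norm (x t0) + F))"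
  proof (rule perturbed_solution_bound[OF W l_cont _ t_star(1) _ _ \<nu>])
    show "((\<lambda>s. spectral_norm (W s)) has_real_derivative p s * spectral_norm (W s)) (at s within {t0..})"
      if "s \<ge> t_star" for s
      unfolding p using that t_star by (intro spectral_norm_has_log_norm_rate[OF W] simple) auto
    show "p s + condition_number (W s) * l s \<le> - \<nu>" if "s \<ge> t_star" for s
      using rate[OF that] by (simp add: k)
  qed (use l_bound k in \<open>auto simp: less_imp_le\<close>)
  obtain \<epsilon>1 where \<epsilon>1: "\<epsilon>1 > 0"
    "\<And>F x0 s. 0 \<le> F \<Longrightarrow> F < \<epsilon>1 \<Longrightarrow> norm x0 < \<epsilon>1 \<Longrightarrow> s \<in> {t0..t1} \<Longrightarrow> x F x0 s \<in> \<Omega>1"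
    using stays by blast
  obtain \<rho> where \<rho>: "\<rho> > 0" "\<And>v. norm v \<le> \<rho> \<Longrightarrow> v \<in> \<Omega>1"
    using \<Omega>1_nhd(2) unfolding mem_interior_cball by (auto simp: subset_iff)
  obtain \<epsilon>2 where \<epsilon>2: "\<epsilon>2 > 0" "\<And>v. norm v < \<epsilon>2 \<Longrightarrow> v \<in> N"
    using N_nhd unfolding mem_interior by (auto simp: subset_iff)
  \<comment> \<open>With \<open>\<rho> / (8 * C)\<close> the data contribute at most \<open>\<rho> / 4\<close> to the estimate of the solution.\<close>
  define \<epsilon> where "\<epsilon> = min \<epsilon>1 (min \<epsilon>2 (min F_max (\<rho> / (8 * C))))"
  have \<epsilon>: "\<epsilon> > 0" using \<epsilon>1 \<epsilon>2 F_max \<rho> C by (simp add: \<epsilon>_def)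
  have sol: "unique_solution (\<lambda>t v. A t *v v + f t v + F *\<^sub>R \<phi> t) t0 x0 (x F x0)"
    if "0 \<le> F" "F < \<epsilon>" "norm x0 < \<epsilon>" for F x0
    using that by (intro solution \<epsilon>2) (auto simp: \<epsilon>_def)
  \<comment> \<open>The linear estimate without an a priori bound on the solution: the estimate itself keeps the
      solution in the ball of radius \<open>\<rho>\<close>, where the bound on \<open>f\<close> is available.\<close>
  have key: "(\<forall>s\<in>{t0..t_star}. norm (x F x0 s) \<le> C * (norm x0 + F)) \<and>
       (\<forall>t\<ge>t_star. norm (x F x0 t) \<le> b / \<nu> + exp (- \<nu> * (t - t_star)) * (C * (norm x0 + F)))"
    if F: "0 \<le> F" "F < \<epsilon>" and x0: "norm x0 < \<epsilon>"
      and b: "\<And>s. s \<ge> t_star \<Longrightarrow> k s * F \<le> b" "0 \<le> b" "b / \<nu> < \<rho> / 2" for F x0 b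
  proof -
    let ?x = "x F x0"
    have start: "?x t0 = x0" using sol[OF F x0] by (simp add: unique_solution_def)
    have der: "(?x has_vector_derivative A s *v ?x s + (f s (?x s) + F *\<^sub>R \<phi> s)) (at s within {t0..})"
      if "s \<ge> t0" for s
      using sol[OF F x0] that by (simp add: unique_solution_def ode_solution_def add.assoc)
    have g: "norm (f s (?x s) + F *\<^sub>R \<phi> s) \<le> l s * norm (?x s) + F" if "s \<ge> t0" "?x s \<in> \<Omega>1" for s
      using norm_triangle_ineq[of "f s (?x s)" "F *\<^sub>R \<phi> s"] f_bound[OF that] \<phi>_norm[OF that(1)] F by simp
    have early: "?x s \<in> \<Omega>1" if "s \<in> {t0..t_star}" for s
      using \<epsilon>1(2)[of F x0 s] F x0 that t_star by (auto simp: \<epsilon>_def)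
    have bound: "(\<forall>s\<in>{t0..t_star}. norm (?x s) \<le> C * (norm x0 + F)) \<and>
        norm (?x T) \<le> b / \<nu> + exp (- \<nu> * (T - t_star)) * (C * (norm x0 + F))"
      if T: "T \<ge> t_star" "\<And>s. s \<in> {t_star..T} \<Longrightarrow> ?x s \<in> \<Omega>1" for T
    proof -
      have "?x s \<in> \<Omega>1" if "s \<in> {t0..T}" for s
        using early[of s] T(2)[of s] that by (cases "s \<le> t_star") auto
      then have gT: "norm (f s (?x s) + F *\<^sub>R \<phi> s) \<le> l s * norm (?x s) + F" if "s \<in> {t0..T}" for s
        using that by (intro g) auto
      show ?thesis
        using C(2)[OF der gT F(1) b(1) T(1)] unfolding start .
    qed
    have small: "C * (norm x0 + F) < \<rho> / 2"
    proof -
      have "norm x0 + F < \<rho> / (8 * C) + \<rho> / (8 * C)" using F x0 by (auto simp: \<epsilon>_def)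
      then have "C * (norm x0 + F) < C * (\<rho> / (8 * C) + \<rho> / (8 * C))"
        using C(1) by (rule mult_strict_left_mono)
      also have "\<dots> = \<rho> / 4" using C(1) by (simp add: field_simps)
      finally show ?thesis using \<rho>(1) by simp
    qed
    have inside: "norm (?x t) < \<rho>" if "t \<ge> t_star" for t
    proof (rule confined_by_strict_bound[OF _ _ _ that])
      show "continuous_on {t_star..} ?x"
        using continuous_on_vector_derivative[of "{t0..}" ?x, OF der] t_star
        by (auto intro: continuous_on_subset)
      have "norm (?x t_star) \<le> C * (norm x0 + F)"
        using bound[of t_star] early[of t_star] t_star by simp
      then show "norm (?x t_star) < \<rho>" using small \<rho>(1) by linarith
      show "norm (?x T) < \<rho>" if T: "T \<ge> t_star" "\<And>s. s \<in> {t_star..T} \<Longrightarrow> norm (?x s) \<le> \<rho>" for T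
      proof -
        have "exp (- \<nu> * (T - t_star)) * (C * (norm x0 + F)) \<le> 1 * (C * (norm x0 + F))"
          using \<nu> T(1) C(1) F by (intro mult_right_mono) auto
        moreover have "norm (?x T) \<le> b / \<nu> + exp (- \<nu> * (T - t_star)) * (C * (norm x0 + F))"
          using bound[OF T(1)] T(2) \<rho>(2) by blast
        ultimately show ?thesis using small b(3) by linarith
      qed
    qed
    have "?x s \<in> \<Omega>1" if "s \<ge> t_star" for s
      using inside[OF that] by (intro \<rho>(2)) simp
    then show ?thesis using bound[of t_star] bound by auto
  qed

  have "exponentially_stable (\<lambda>t v. A t *v v + f t v) t0"
    unfolding exponentially_stable_def
  proof (intro conjI allI impI exI)
    show "A t *v 0 + f t 0 = 0" if "t0 \<le> t" for t using f_zero[OF that] by simp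
    show "0 < \<epsilon>" by (rule \<epsilon>)
    show "0 < C * exp (\<nu> * (t_star - t0))" using C(1) by simp
    show "0 < \<nu>" by (rule \<nu>)
    fix x0 :: "real ^ 'n" assume x0: "norm x0 < \<epsilon>"
    have us: "unique_solution (\<lambda>t v. A t *v v + f t v) t0 x0 (x 0 x0)"
      using sol[of 0 x0] \<epsilon> x0 by simp
    then show "ode_solution (\<lambda>t v. A t *v v + f t v) {t0..} (x 0 x0)" "x 0 x0 t0 = x0"
      by (auto simp: unique_solution_def)
    fix y t assume y: "ode_solution (\<lambda>t v. A t *v v + f t v) {t0..} y \<and> y t0 = x0" and t: "t0 \<le> t"
    \<comment> \<open>Uniqueness is stated on nondegenerate intervals, hence \<open>t + 1\<close>, since \<open>t = t0\<close> may occur.\<close>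
    have "ode_solution (\<lambda>t v. A t *v v + f t v) {t0..t + 1} y"
      unfolding ode_solution_def
    proof
      fix r assume r: "r \<in> {t0..t + 1}"
      then have "(y has_vector_derivative A r *v y r + f r (y r)) (at r within {t0..})"
        using y by (simp add: ode_solution_def)
      then show "(y has_vector_derivative A r *v y r + f r (y r)) (at r within {t0..t + 1})"
        by (rule has_vector_derivative_within_subset) auto
    qed
    moreover have "t0 < t + 1" "t \<in> {t0..t + 1}" using t by auto
    ultimately have yt: "y t = x 0 x0 t"
      using us[unfolded unique_solution_def, THEN conjunct2, THEN conjunct2, rule_format, of "t + 1" y t] y
      by simp
    have est: "(\<forall>s\<in>{t0..t_star}. norm (x 0 x0 s) \<le> C * norm x0) \<and>
       (\<forall>t\<ge>t_star. norm (x 0 x0 t) \<le> exp (- \<nu> * (t - t_star)) * (C * norm x0))"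
      using key[of 0 x0 0] \<epsilon> x0 \<rho>(1) by simp
    have split: "C * exp (\<nu> * (t_star - t0)) * norm x0 * exp (- \<nu> * (t - t0))
        = exp (- \<nu> * (t - t_star)) * (C * norm x0)"
    proof -
      have "exp (\<nu> * (t_star - t0)) * exp (- \<nu> * (t - t0)) = exp (- \<nu> * (t - t_star))"
        unfolding exp_add[symmetric] by (simp add: algebra_simps)
      then show ?thesis by (simp only: mult.assoc mult.left_commute mult.commute)
    qed
    show "norm (y t) \<le> C * exp (\<nu> * (t_star - t0)) * norm x0 * exp (- \<nu> * (t - t0))"
      unfolding split yt
    proof (cases "t \<ge> t_star")
      case False
      then have "norm (x 0 x0 t) \<le> 1 * (C * norm x0)" using est t by simp
      also have "\<dots> \<le> exp (- \<nu> * (t - t_star)) * (C * norm x0)"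
        using False \<nu> C(1) by (intro mult_right_mono) (auto simp: mult_le_0_iff)
      finally show "norm (x 0 x0 t) \<le> exp (- \<nu> * (t - t_star)) * (C * norm x0)" .
    qed (use est in auto)
  qed
  moreover have "\<exists>\<epsilon>>0. \<forall>F_hat x0. 0 \<le> F_hat \<and> F_hat < \<epsilon> \<and> norm x0 < \<epsilon> \<longrightarrow>
         bounded (x F_hat x0 ` {t0..}) \<and>
         Limsup at_top (\<lambda>t. ereal (norm (x F_hat x0 t))) \<le> ereal (F_hat * k_hat / \<nu>)"
    if k_hat: "(SUP t\<in>{t0..}. ereal (k t)) = ereal k_hat" for k_hat
  proof -
    have k_le: "k s \<le> k_hat" if "s \<ge> t0" for s
      using SUP_upper[of s "{t0..}" "\<lambda>t. ereal (k t)"] that k_hat by simp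
    have "0 \<le> k t0" by (simp add: k condition_number_def spectral_norm_nonneg)
    then have k_hat_nonneg: "0 \<le> k_hat" using k_le[of t0] by simp
    \<comment> \<open>The second term makes \<open>F * k_hat / \<nu> < \<rho> / 2\<close>; adding 1 avoids division by zero.\<close>
    define \<epsilon>' where "\<epsilon>' = min \<epsilon> (\<rho> * \<nu> / (2 * (k_hat + 1)))"
    have "\<epsilon>' > 0" using \<epsilon> \<rho> \<nu> k_hat_nonneg by (simp add: \<epsilon>'_def)
    moreover have "bounded (x F x0 ` {t0..}) \<and>
        Limsup at_top (\<lambda>t. ereal (norm (x F x0 t))) \<le> ereal (F * k_hat / \<nu>)"
      if F: "0 \<le> F" "F < \<epsilon>'" and x0: "norm x0 < \<epsilon>'" for F x0
    proof
      let ?b = "F * k_hat / \<nu>" and ?G = "C * (norm x0 + F)"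
      have "F * (k_hat + 1) < \<rho> * \<nu> / 2"
        using F k_hat_nonneg by (simp add: \<epsilon>'_def field_simps)
      then have "?b < \<rho> / 2" using F \<nu> by (simp add: field_simps)
      then have est: "(\<forall>s\<in>{t0..t_star}. norm (x F x0 s) \<le> ?G) \<and>
          (\<forall>t\<ge>t_star. norm (x F x0 t) \<le> ?b + exp (- \<nu> * (t - t_star)) * ?G)"
        using F x0 k_hat_nonneg k_le t_star(1)
        by (intro key) (auto simp: \<epsilon>'_def mult.commute[of F] intro!: mult_right_mono)
      have nonneg: "0 \<le> ?b" "0 \<le> ?G" using F k_hat_nonneg \<nu> C(1) by auto
      have "norm (x F x0 t) \<le> ?b + ?G" if "t \<ge> t0" for t
      proof (cases "t \<le> t_star")
        case True
        then have "norm (x F x0 t) \<le> ?G" using est that by simp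
        then show ?thesis using nonneg(1) by linarith
      next
        case False
        then have "exp (- \<nu> * (t - t_star)) * ?G \<le> 1 * ?G"
          using \<nu> by (intro mult_right_mono nonneg) auto
        moreover have "norm (x F x0 t) \<le> ?b + exp (- \<nu> * (t - t_star)) * ?G" using est False by simp
        ultimately show ?thesis by linarith
      qed
      then show "bounded (x F x0 ` {t0..})" unfolding bounded_iff by blast
      have "((\<lambda>t. ?b + exp (- \<nu> * (t - t_star)) * ?G) \<longlongrightarrow> ?b + 0 * ?G) at_top"
      proof (intro tendsto_intros filterlim_compose[OF exp_at_bot])
        have "filterlim (\<lambda>t. - t_star + t) at_top at_top"
          by (rule filterlim_tendsto_add_at_top[OF tendsto_const filterlim_ident])
        then have "filterlim (\<lambda>t. - \<nu> * (- t_star + t)) at_bot at_top"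
          using \<nu> by (intro filterlim_tendsto_neg_mult_at_bot[OF tendsto_const]) auto
        then show "filterlim (\<lambda>t. - \<nu> * (t - t_star)) at_bot at_top" by simp
      qed
      then have "((\<lambda>t. ereal (?b + exp (- \<nu> * (t - t_star)) * ?G)) \<longlongrightarrow> ereal ?b) at_top"
        by simp
      then have "Limsup at_top (\<lambda>t. ereal (?b + exp (- \<nu> * (t - t_star)) * ?G)) = ereal ?b"
        by (intro lim_imp_Limsup) auto
      moreover have "Limsup at_top (\<lambda>t. ereal (norm (x F x0 t)))
          \<le> Limsup at_top (\<lambda>t. ereal (?b + exp (- \<nu> * (t - t_star)) * ?G))"
        using est by (intro Limsup_mono) (auto simp: eventually_at_top_linorder)
      ultimately show "Limsup at_top (\<lambda>t. ereal (norm (x F x0 t))) \<le> ereal ?b" by simp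
    qed
    ultimately show ?thesis by blast
  qed
  ultimately show ?thesis by blast
qed

end
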